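(* Let $\hat D$ be a co-loopless Le-diagram of type $(k,n)$ and let $D$ be the filling produced from $\hat D$ by the algorithm described in the context. Then $D$ is loopless (every column of $D$ contains a $+$) and has dimension $\dim(S_D)=\dim(S_{\hat D})-2k+(n-1)$, i.e. the number of $+$'s in $D$ equals the number of $+$'s in $\hat D$ minus $2k$ plus $n-1$.
   Context: Le-diagrams. For $0\le k\le n$, a Le-diagram of type $(k,n)$ is a filling of a Young diagram $\lambda$ (English convention, in the top-left corner of a $k\times(n-k)$ rectangle and fitting inside it) with $0$ and $+$ such that no box containing $0$ has both a $+$ above it in its column and a $+$ to its left in its row. The south-east boundary of $\lambda$ is a lattice path of $n$ unit steps from the top-right to the bottom-left corner of the rectangle, with steps labelled $1,\dots,n$ in order; vertical step labels are row labels (rows may have length $0$), horizontal step labels are column labels. Box $(i,j)$ is the box in row $i$, column $j$ (existing only inside $\lambda$, with $i<j$). "Below" = larger row label, "to the left" = larger column label. The decorated permutation $\hat\pi$ of $\hat D$ is read from the pipe dream: each $0$ becomes a crossing, each $+$ an elbow (entering from bottom exits left, entering from right exits top); north-west boundary ends of rows/columns carry the same labels; the pipe from boundary step $i$ (moving left from a row label, up from a column label) exits at $j$ and $\hat\pi(i)=j$. $\hat D$ is co-loopless if every row is nonempty and contains a $+$ (no co-loops). The positroid cell $S_D$ indexed by a Le-diagram $D$ has dimension equal to the number of $+$'s in $D$. The algorithm. Let the row labels of $\hat D$ be $b_1<\dots<b_k$ and $a_n=\hat\pi(1)$. $D$ has the Young-diagram shape of type $(k+1,n)$ with row labels $\{b_1,\dots,b_k,a_n\}$.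 $L_u$ = column label of the leftmost $+$ in row $b_u$ of $\hat D$; for row $a_n$ set $L=\infty$ and regard its row in $\hat D$ as all $0$'s. $W(r)$ = label of the next row of $D$ below row $r$, or $n+1$ for the last row. A $0$ of $\hat D$ is restricted if some box to its left in its row contains $+$, else unrestricted. For row $r$ and column $\ell$ of $D$: (i) $\hat D$ has $+$ at $(r,\ell)$ (never for $r=a_n$); (ii) some row label $b'>r$ of $\hat D$ has $+$ at $(b',\ell)$ with every box $(b,\ell)$ of $\hat D$, $b$ a row label, $r<b<b'$, containing an unrestricted $0$; (iii) every existing box $(b,\ell)$ of $\hat D$ with $b>r$ a row label contains an unrestricted $0$. Row types: (I) rows $b_u$ with box $(b_u,a_n)$ of $\hat D$ nonexistent or $0$; (II) rows $b_u$ with $+$ at $(b_u,a_n)$; (III) row $a_n$. Type (I)/(III) row $r$ with $L$ and $W=W(r)$: box $(r,\ell)$ gets $+$ if $r<\ell<\min(W,L)$; if $W<\ell<L$, $+$ iff (i), (ii) or (iii) holds, else $0$; $0$ if $\ell\ge L$. Type (II) row $r$: boxes with $\ell<a_n$ follow the type (I) rule; boxes with $\ell>a_n$ get $+$ exactly when $\hat D$ has $+$ at $(r,\ell)$. *)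

theory Defs
  imports Main "HOL-Library.Extended_Nat"
begin

(* A Young diagram in the top-left corner of a k x (n-k) rectangle is given by its
   south-east boundary path, i.e. by the k-element set of labels in {1..n} of the vertical
   steps.  The row with label r then has one box for every column label c > r, and (r, c)
   denotes that box.  A smaller row label is further up, a larger column label is further
   to the left.  A box of the diagram outside the set of pluses contains 0. *)

record filling =
  num_steps :: nat
  row_labels :: "nat set"
  pluses :: "(nat \<times> nat) set"

definition col_labels :: "filling \<Rightarrow> nat set" where
  "col_labels D = {1..num_steps D} - row_labels D"

definition boxes :: "filling \<Rightarrow> (nat \<times> nat) set" where
  "boxes D = {(r, c). r \<in> row_labels D \<and> c \<in> col_labels D \<and> r < c}"

definition le_diagram :: "nat \<Rightarrow> nat \<Rightarrow> filling \<Rightarrow> bool" where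
  "le_diagram k n D \<longleftrightarrow>
     num_steps D = n \<and> row_labels D \<subseteq> {1..n} \<and> card (row_labels D) = k \<and>
     pluses D \<subseteq> boxes D \<and>
     (\<forall>(r, c) \<in> boxes D - pluses D.
        \<not> ((\<exists>r'<r. (r', c) \<in> pluses D) \<and> (\<exists>c'>c. (r, c') \<in> pluses D)))"

definition co_loopless :: "filling \<Rightarrow> bool" where
  "co_loopless D \<longleftrightarrow> (\<forall>r \<in> row_labels D. \<exists>c. (r, c) \<in> boxes D \<and> (r, c) \<in> pluses D)"

definition loopless :: "filling \<Rightarrow> bool" where
  "loopless D \<longleftrightarrow> (\<forall>c \<in> col_labels D. \<exists>r. (r, c) \<in> boxes D \<and> (r, c) \<in> pluses D)"

definition cell_dim :: "filling \<Rightarrow> nat" where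
  "cell_dim D = card (pluses D)"

(* The pipe dream is traversed on the grid of all pairs (r, c), one unit step at a time.
   In "pipe_exit D h r c" the pipe has just passed position (r, c) and leaves it with
   heading h.  At a plus it turns, everywhere else it goes straight on: that is the crossing
   at a box containing 0, and a pair that is not a box is merely skipped.  A pipe leaving
   through the left end of row r, or the top end of column c, exits at that label. *)

datatype heading = Leftward | Upward

function pipe_exit :: "filling \<Rightarrow> heading \<Rightarrow> nat \<Rightarrow> nat \<Rightarrow> nat" where
  "pipe_exit D Leftward r c =
     (if num_steps D \<le> c then r
      else pipe_exit D (if (r, c + 1) \<in> pluses D then Upward else Leftward) r (c + 1))"
| "pipe_exit D Upward r c =
     (if r \<le> 1 then c
      else pipe_exit D (if (r - 1, c) \<in> pluses D then Leftward else Upward) (r - 1) c)"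
  by pat_completeness auto
termination
  by (relation "measure (\<lambda>(D, h, r, c). r + (num_steps D - c))") auto

declare pipe_exit.simps [simp del]

(* The underlying map of the decorated permutation; the decoration of its fixed points
   is not used. *)
definition decorated_perm :: "filling \<Rightarrow> nat \<Rightarrow> nat" where
  "decorated_perm D i =
     pipe_exit D (if i \<in> row_labels D then Leftward else Upward) i i"

definition unrestricted_zero :: "filling \<Rightarrow> nat \<Rightarrow> nat \<Rightarrow> bool" where
  "unrestricted_zero D r c \<longleftrightarrow>
     (r, c) \<in> boxes D \<and> (r, c) \<notin> pluses D \<and> \<not> (\<exists>c'>c. (r, c') \<in> pluses D)"

(* In the algorithm below, E is the given Le-diagram (D with a hat) and alg_filling E is
   the output D; new_row is a_n, leftmost_plus is L, and next_row is W.  The rule type_I_plus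
   also serves the row a_n of type (III). *)

definition new_row :: "filling \<Rightarrow> nat" where
  "new_row E = decorated_perm E 1"

definition alg_rows :: "filling \<Rightarrow> nat set" where
  "alg_rows E = insert (new_row E) (row_labels E)"

definition leftmost_plus :: "filling \<Rightarrow> nat \<Rightarrow> enat" where
  "leftmost_plus E r =
     (if r = new_row E then \<infinity> else enat (Max {c. (r, c) \<in> pluses E}))"

definition next_row :: "filling \<Rightarrow> nat \<Rightarrow> nat" where
  "next_row E r =
     (if \<exists>r' \<in> alg_rows E. r < r' then Min {r' \<in> alg_rows E. r < r'}
      else num_steps E + 1)"

definition cond_i :: "filling \<Rightarrow> nat \<Rightarrow> nat \<Rightarrow> bool" where
  "cond_i E r l \<longleftrightarrow> (r, l) \<in> pluses E"

definition cond_ii :: "filling \<Rightarrow> nat \<Rightarrow> nat \<Rightarrow> bool" where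
  "cond_ii E r l \<longleftrightarrow>
     (\<exists>b' \<in> row_labels E. r < b' \<and> (b', l) \<in> pluses E \<and>
        (\<forall>b \<in> row_labels E. r < b \<and> b < b' \<longrightarrow> unrestricted_zero E b l))"

definition cond_iii :: "filling \<Rightarrow> nat \<Rightarrow> nat \<Rightarrow> bool" where
  "cond_iii E r l \<longleftrightarrow>
     (\<forall>b \<in> row_labels E. r < b \<and> (b, l) \<in> boxes E \<longrightarrow> unrestricted_zero E b l)"

definition type_II_row :: "filling \<Rightarrow> nat \<Rightarrow> bool" where
  "type_II_row E r \<longleftrightarrow> r \<in> row_labels E \<and> (r, new_row E) \<in> pluses E"

definition type_I_plus :: "filling \<Rightarrow> nat \<Rightarrow> nat \<Rightarrow> bool" where
  "type_I_plus E r l \<longleftrightarrow>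
     (r < l \<and> enat l < min (enat (next_row E r)) (leftmost_plus E r)) \<or>
     (next_row E r < l \<and> enat l < leftmost_plus E r \<and>
        (cond_i E r l \<or> cond_ii E r l \<or> cond_iii E r l))"

definition alg_plus :: "filling \<Rightarrow> nat \<Rightarrow> nat \<Rightarrow> bool" where
  "alg_plus E r l \<longleftrightarrow>
     (if type_II_row E r \<and> new_row E < l then (r, l) \<in> pluses E else type_I_plus E r l)"

definition alg_filling :: "filling \<Rightarrow> filling" where
  "alg_filling E =
     \<lparr>num_steps = num_steps E,
      row_labels = alg_rows E,
      pluses = {(r, l). r \<in> alg_rows E \<and> l \<in> {1..num_steps E} - alg_rows E \<and> r < l \<and>
                        alg_plus E r l}\<rparr>"

end

(* Write a for the new row label.  If 1 is a row label, then row 1 is the top row, so the pipe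
   from 1 turns up at the rightmost plus of row 1 and a is the column label of that plus;
   otherwise a = 1.  Passing from the given diagram to the output deletes exactly one plus from
   every row r, namely (r, a) if it is a plus and the leftmost plus otherwise, and creates
   exactly one plus in every column other than a, namely in the lowest restricted 0 of that
   column.  Here row a counts as a row of restricted 0's, and in columns to the left of a the rows
   above a are disregarded.  The dimension changes by -k + (n - k - 1). *)
theory Submission
  imports Defs
begin

section \<open>Pipes in the top row of the grid\<close>

lemma pipe_exit_Upward_top: "pipe_exit D Upward (Suc 0) c = c"
  by (simp add: pipe_exit.simps)

text \<open>The pipe crosses straight until its first plus. Since row 1 is the top of the grid, the
  turn upward there is already the exit.\<close>

lemma pipe_exit_Leftward_top:
  assumes "(1, a) \<in> pluses D" "a \<le> num_steps D" "c < a"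
    and "\<And>c'. c < c' \<Longrightarrow> c' < a \<Longrightarrow> (1, c') \<notin> pluses D"
  shows "pipe_exit D Leftward 1 c = a"
  using assms
proof (induction "a - c" arbitrary: c)
  case 0
  then show ?case by simp
next
  case (Suc m)
  show ?case
  proof (cases "c + 1 = a")
    case True
    then show ?thesis
      using Suc.prems by (subst pipe_exit.simps) (simp add: pipe_exit_Upward_top)
  next
    case False
    then have "pipe_exit D Leftward 1 (c + 1) = a"
      using Suc.prems Suc.hyps(2) by (intro Suc.hyps(1)) auto
    then show ?thesis
      using Suc.prems False by (subst pipe_exit.simps) simp
  qed
qed

section \<open>The given diagram and the position of the new row label\<close>

locale co_loopless_le_diagram =
  fixes k n :: nat and E :: filling
  assumes n_pos: "1 \<le> n"
    and le_diagram: "le_diagram k n E"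
    and co_loopless: "co_loopless E"
begin

abbreviation "R \<equiv> row_labels E"
abbreviation "P \<equiv> pluses E"
abbreviation "a \<equiv> new_row E"

lemma num_steps_eq: "num_steps E = n"
  and rows_subset: "R \<subseteq> {1..n}"
  and card_rows: "card R = k"
  and pluses_subset: "P \<subseteq> boxes E"
  using le_diagram by (auto simp: le_diagram_def)

lemma finite_rows: "finite R"
  using rows_subset finite_subset by blast

lemma plusD:
  assumes "(r, c) \<in> P"
  shows "r \<in> R" "c \<notin> R" "1 \<le> c" "c \<le> n" "r < c"
  using assms pluses_subset by (auto simp: boxes_def col_labels_def num_steps_eq)

lemma finite_pluses: "finite P"
  by (rule finite_subset[of _ "R \<times> {..n}"]) (auto simp: finite_rows dest: plusD)

lemma finite_row_pluses: "finite {c. (r, c) \<in> P}"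
  by (rule finite_subset[of _ "{..n}"]) (auto dest: plusD)

lemma le_condition:
  assumes "r \<in> R" "c \<in> col_labels E" "r < c" "r' < r" "(r', c) \<in> P" "c < c'" "(r, c') \<in> P"
  shows "(r, c) \<in> P"
proof (rule ccontr)
  assume "(r, c) \<notin> P"
  then have "(r, c) \<in> boxes E - P"
    using assms by (simp add: boxes_def)
  then show False
    using le_diagram assms unfolding le_diagram_def by blast
qed

lemma row_has_plus: "r \<in> R \<Longrightarrow> \<exists>c. (r, c) \<in> P"
  using co_loopless by (auto simp: co_loopless_def)

lemma new_row_cases:
  obtains (loop) "1 \<notin> R" "a = 1"
  | (rightmost) "1 \<in> R" "(1, a) \<in> P" "\<And>c. (1, c) \<in> P \<Longrightarrow> a \<le> c"
proof (cases "1 \<in> R")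
  case False
  then have "a = 1"
    by (simp add: new_row_def decorated_perm_def pipe_exit_Upward_top)
  with False show thesis by (rule loop)
next
  case True
  \<comment> \<open>Larger labels lie further left, so the minimum is the rightmost plus, the first
    one that the pipe meets.\<close>
  define m where "m = Min {c. (1, c) \<in> P}"
  have m: "(1, m) \<in> P" "\<And>c. (1, c) \<in> P \<Longrightarrow> m \<le> c"
    using Min_in[OF finite_row_pluses, of 1] row_has_plus[OF True]
      Min_le[OF finite_row_pluses, of _ 1]
    unfolding m_def by auto
  have "pipe_exit E Leftward 1 1 = m"
    by (rule pipe_exit_Leftward_top) (use m plusD[of 1 m] num_steps_eq in force)+
  then have "a = m"
    using True by (simp add: new_row_def decorated_perm_def)
  with True m show thesis by (intro rightmost) auto
qed

lemma new_row_not_row: "a \<notin> R"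
  by (cases rule: new_row_cases) (use plusD in auto)

lemma new_row_bounds: "1 \<le> a" "a \<le> n"
  by (cases rule: new_row_cases; use plusD n_pos in force)+

lemma new_row_col: "a \<in> col_labels E"
  using new_row_not_row new_row_bounds by (simp add: col_labels_def num_steps_eq)

text \<open>For \<open>1 < r\<close> the plus at \<open>(1, a)\<close> is above
  \<open>(r, a)\<close> and the given one is to its left, so the Le-condition applies. Hence a row
  above \<open>a\<close> that is not of type (II) has no plus to the left of column
  \<open>a\<close>.\<close>

lemma plus_left_of_new_row:
  assumes "r < a" "a < c" "(r, c) \<in> P"
  shows "(r, a) \<in> P"
proof (cases rule: new_row_cases)
  case loop
  then have "r = 0" using assms(1) by simp
  then show ?thesis using plusD(1)[OF assms(3)] rows_subset by auto
next
  case rightmost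
  have "1 \<le> r" using plusD(1)[OF assms(3)] rows_subset by auto
  then consider "r = 1" | "1 < r" by linarith
  then show ?thesis
  proof cases
    case 1
    then show ?thesis using rightmost by simp
  next
    case 2
    then show ?thesis
      using le_condition[OF _ new_row_col _ _ rightmost(2)] assms plusD(1)[OF assms(3)] by blast
  qed
qed

section \<open>Restricted zeros of a column and lost pluses of a row\<close>

definition plus_to_left :: "nat \<Rightarrow> nat \<Rightarrow> bool" where
  "plus_to_left r l \<longleftrightarrow> r = a \<or> (\<exists>c>l. (r, c) \<in> P)"

text \<open>Eliminates the extended naturals; the disjunct \<open>r = a\<close> of
  \<open>plus_to_left\<close> encodes the value infinity.\<close>

lemma less_leftmost_plus_iff:
  assumes "r \<in> alg_rows E"
  shows "enat l < leftmost_plus E r \<longleftrightarrow> plus_to_left r l"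
proof (cases "r = a")
  case True
  then show ?thesis by (simp add: leftmost_plus_def plus_to_left_def)
next
  case False
  then have "r \<in> R" using assms by (simp add: alg_rows_def)
  then have "{c. (r, c) \<in> P} \<noteq> {}" using row_has_plus by auto
  then show ?thesis
    using False by (simp add: leftmost_plus_def plus_to_left_def Max_gr_iff finite_row_pluses)
      blast
qed

text \<open>The conjunct \<open>l < a \<or> a \<le> r\<close> leaves out the boxes above row
  \<open>a\<close> and left of column \<open>a\<close>, where the algorithm never creates a
  plus.\<close>

definition restricted_rows :: "nat \<Rightarrow> nat set" where
  "restricted_rows l =
     {r \<in> alg_rows E. r < l \<and> (l < a \<or> a \<le> r) \<and> (r, l) \<notin> P \<and> plus_to_left r l}"

definition gain_row :: "nat \<Rightarrow> nat" where
  "gain_row l = Max (restricted_rows l)"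

lemma finite_restricted_rows: "finite (restricted_rows l)"
  unfolding restricted_rows_def by (rule finite_subset[of _ "{..<l}"]) auto

text \<open>To the left of column \<open>a\<close> the row \<open>a\<close> itself qualifies. To the
  right of it row 1 does, having its rightmost plus in column \<open>a\<close>.\<close>

lemma restricted_rows_nonempty:
  assumes "l \<in> col_labels E" "l \<noteq> a"
  shows "restricted_rows l \<noteq> {}"
proof (cases "a < l")
  case True
  then have "a \<in> restricted_rows l"
    using new_row_not_row plusD(1)
    by (auto simp: restricted_rows_def alg_rows_def plus_to_left_def)
  then show ?thesis by blast
next
  case False
  then have "l < a" using assms by simp
  moreover have l: "1 \<le> l" using assms by (simp add: col_labels_def)
  ultimately show ?thesis
  proof (cases rule: new_row_cases)
    case loop
    then show ?thesis using \<open>l < a\<close> l by simp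
  next
    case rightmost
    then have "1 < l" using assms l by (cases "l = 1") (auto simp: col_labels_def)
    then have "1 \<in> restricted_rows l"
      using rightmost \<open>l < a\<close>
      by (force simp: restricted_rows_def alg_rows_def plus_to_left_def)
    then show ?thesis by blast
  qed
qed

lemma gain_row_in:
  assumes "l \<in> col_labels E" "l \<noteq> a"
  shows "gain_row l \<in> restricted_rows l"
  unfolding gain_row_def
  using Max_in[OF finite_restricted_rows restricted_rows_nonempty[OF assms]] .

lemma gain_row_eq_iff:
  assumes "r \<in> restricted_rows l"
  shows "gain_row l = r \<longleftrightarrow> (\<forall>b \<in> restricted_rows l. b \<le> r)"
  using assms Max_eq_iff[OF finite_restricted_rows, of l r] by (auto simp: gain_row_def)

text \<open>Column \<open>a\<close> is absent from the output, so a plus in it is lost. In a row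
  without one, the strict bound \<open>enat l < leftmost_plus E r\<close> removes the leftmost
  plus.\<close>

definition lost_plus :: "nat \<Rightarrow> nat \<times> nat" where
  "lost_plus r = (r, if (r, a) \<in> P then a else Max {c. (r, c) \<in> P})"

lemma lost_plus_in: "r \<in> R \<Longrightarrow> lost_plus r \<in> P"
  using Max_in[OF finite_row_pluses, of r] row_has_plus[of r] by (auto simp: lost_plus_def)

lemma lost_plus_iff:
  "(r, l) \<in> lost_plus ` R \<longleftrightarrow>
     (r, l) \<in> P \<and> (if (r, a) \<in> P then l = a else \<not> (\<exists>c>l. (r, c) \<in> P))"
proof -
  have "l = Max {c. (r, c) \<in> P} \<longleftrightarrow> (r, l) \<in> P \<and> \<not> (\<exists>c>l. (r, c) \<in> P)" if "r \<in> R"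
    using Max_eq_iff[OF finite_row_pluses, of r l] row_has_plus[OF that]
    by (auto simp: not_less eq_commute[of l])
  moreover have "(r, l) \<in> lost_plus ` R \<longleftrightarrow>
      r \<in> R \<and> l = (if (r, a) \<in> P then a else Max {c. (r, c) \<in> P})"
    by (auto simp: lost_plus_def)
  ultimately show ?thesis
    using plusD(1) by (metis (no_types, lifting))
qed

section \<open>Evaluation of the rules of the algorithm\<close>

lemma next_row_cases:
  assumes "r \<in> alg_rows E" "l \<notin> alg_rows E" "l \<le> n"
  obtains "l < next_row E r" "\<And>b. b \<in> alg_rows E \<Longrightarrow> r < b \<Longrightarrow> l < b"
  | "next_row E r < l"
proof (cases "\<exists>r' \<in> alg_rows E. r < r'")
  case True
  let ?S = "{r' \<in> alg_rows E. r < r'}"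
  have fin: "finite ?S" using finite_rows by (simp add: alg_rows_def)
  have eq: "next_row E r = Min ?S" using True by (simp add: next_row_def)
  have "next_row E r \<in> ?S" unfolding eq using fin True by (intro Min_in) auto
  \<comment> \<open>Equality is excluded because \<open>next_row E r\<close> is a row label of the
    output and \<open>l\<close> is not.\<close>
  then consider "l < next_row E r" | "next_row E r < l"
    using assms by (cases l "next_row E r" rule: linorder_cases) auto
  then show thesis
  proof cases
    case 1
    have "l < b" if "b \<in> alg_rows E" "r < b" for b
      using 1 Min_le[OF fin, of b] that unfolding eq by auto
    with 1 that(1) show thesis by blast
  next
    case 2
    with that(2) show thesis .
  qed
next
  case False
  then show thesis
    using assms num_steps_eq by (intro that(1)) (auto simp: next_row_def)
qed

text \<open>By the Le-condition nothing above a restricted 0 in its column is a plus, so conditions (ii)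
  and (iii) both fail above the lowest restricted 0 of a column.\<close>

lemma cond_ii_or_iii_iff:
  assumes "r \<in> restricted_rows l" "l \<in> col_labels E"
  shows "cond_ii E r l \<or> cond_iii E r l \<longleftrightarrow> gain_row l = r"
proof
  have below_a: "a \<le> r" if "a < l"
    using assms(1) that by (simp add: restricted_rows_def)
  have box: "(b, l) \<in> boxes E \<longleftrightarrow> b \<in> R \<and> b < l" for b
    using assms(2) by (auto simp: boxes_def)
  {
    assume cond: "cond_ii E r l \<or> cond_iii E r l"
    show "gain_row l = r"
      unfolding gain_row_eq_iff[OF assms(1)]
    proof (rule ccontr)
      assume "\<not> (\<forall>b \<in> restricted_rows l. b \<le> r)"
      then obtain b where b: "b \<in> restricted_rows l" "r < b" by auto
      \<comment> \<open>If \<open>b = a\<close>, then \<open>a < l\<close>, and rows above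
        \<open>a\<close> are left out in such a column, against \<open>r < b\<close>.\<close>
      then have "b \<noteq> a" using below_a by (auto simp: restricted_rows_def)
      with b obtain c where b': "b \<in> R" "b < l" "(b, l) \<notin> P" "l < c" "(b, c) \<in> P"
        by (auto simp: restricted_rows_def alg_rows_def plus_to_left_def)
      then have not_uz: "\<not> unrestricted_zero E b l" by (auto simp: unrestricted_zero_def)
      from cond show False
      proof
        assume "cond_iii E r l"
        then show False using b b' not_uz box by (auto simp: cond_iii_def)
      next
        assume "cond_ii E r l"
        then obtain d where d: "(d, l) \<in> P"
          "\<forall>b \<in> R. r < b \<and> b < d \<longrightarrow> unrestricted_zero E b l"
          by (auto simp: cond_ii_def)
        \<comment> \<open>The 0 in row \<open>b\<close> is restricted, so \<open>b\<close> cannot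
          lie strictly between \<open>r\<close> and \<open>d\<close>. The plus in row
          \<open>d\<close> is thus above a 0 with a plus to its left.\<close>
        then have "d < b"
          using b b' not_uz by (cases d b rule: linorder_cases) auto
        then show False using le_condition[OF b'(1) assms(2) b'(2) _ d(1) b'(4,5)] b'(3) by blast
      qed
    qed
  }
  {
    assume "gain_row l = r"
    then have max: "\<forall>b \<in> restricted_rows l. b \<le> r"
      using gain_row_eq_iff[OF assms(1)] by simp
    have uz: "unrestricted_zero E b l" if "b \<in> R" "r < b" "b < l" "(b, l) \<notin> P" for b
    proof -
      have "b \<notin> restricted_rows l" using max that by auto
      moreover have "l < a \<or> a \<le> b"
        using assms(1) that by (auto simp: restricted_rows_def)
      ultimately have "\<not> plus_to_left b l"
        using that by (simp add: restricted_rows_def alg_rows_def)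
      then show ?thesis
        using that box by (auto simp: unrestricted_zero_def plus_to_left_def)
    qed
    show "cond_ii E r l \<or> cond_iii E r l"
    proof (cases "\<exists>d. r < d \<and> (d, l) \<in> P")
      case True
      \<comment> \<open>Only zeros lie between row \<open>r\<close> and the topmost plus below it,
        as (ii) demands of its witness.\<close>
      define d where "d = (LEAST d. r < d \<and> (d, l) \<in> P)"
      have d: "r < d" "(d, l) \<in> P"
        using LeastI_ex[OF True] unfolding d_def by auto
      have "(b, l) \<notin> P" if "r < b" "b < d" for b
        using not_less_Least that unfolding d_def by blast
      then have "cond_ii E r l"
        using d uz plusD[OF d(2)] unfolding cond_ii_def by (meson less_trans)
      then show ?thesis ..
    next
      case False
      then have "cond_iii E r l" using uz box by (auto simp: cond_iii_def)
      then show ?thesis ..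
    qed
  }
qed

text \<open>If \<open>l < next_row E r\<close>, the box is the lowest of its column in the output,
  so a restricted 0 in it is automatically the lowest one. Otherwise (ii) and (iii) single out the
  lowest one.\<close>

lemma type_I_plus_iff:
  assumes r: "r \<in> alg_rows E" "r < l" "l < a \<or> a \<le> r"
    and l: "l \<in> col_labels E" "l \<noteq> a"
  shows "type_I_plus E r l \<longleftrightarrow> plus_to_left r l \<and> ((r, l) \<in> P \<or> gain_row l = r)"
proof -
  have nl: "l \<notin> alg_rows E" "l \<le> n"
    using l by (auto simp: alg_rows_def col_labels_def num_steps_eq)
  have zero: "r \<in> restricted_rows l" if "plus_to_left r l" "(r, l) \<notin> P"
    using that r by (simp add: restricted_rows_def)
  show ?thesis
  proof (cases rule: next_row_cases[OF r(1) nl])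
    case 1
    have "gain_row l = r" if "plus_to_left r l" "(r, l) \<notin> P"
      unfolding gain_row_eq_iff[OF zero[OF that]]
      using 1(2) by (force simp: restricted_rows_def not_less[symmetric])
    then show ?thesis
      using 1(1) r(2) less_leftmost_plus_iff[OF r(1)] by (auto simp: type_I_plus_def)
  next
    case 2
    then show ?thesis
      using zero cond_ii_or_iii_iff[OF _ l(1)] less_leftmost_plus_iff[OF r(1)]
      by (auto simp: type_I_plus_def cond_i_def)
  qed
qed

lemma alg_plus_iff:
  assumes r: "r \<in> alg_rows E" "r < l" and l: "l \<in> col_labels E" "l \<noteq> a"
  shows "alg_plus E r l \<longleftrightarrow> (r, l) \<in> P - lost_plus ` R \<or> r = gain_row l"
proof (cases "l < a \<or> a \<le> r")
  case True
  have gain: "plus_to_left r l" if "gain_row l = r"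
    using gain_row_in[OF l] that by (simp add: restricted_rows_def)
  \<comment> \<open>If \<open>(r, a)\<close> is a plus, then \<open>r < a\<close>, hence
    \<open>l < a\<close>: this plus lies to the left of \<open>l\<close> and is the one
    lost.\<close>
  have "(r, l) \<in> lost_plus ` R \<longleftrightarrow> (r, l) \<in> P \<and> \<not> plus_to_left r l"
    using True l(2) r(2) plusD(1,5)[of r] new_row_not_row
    by (auto simp: lost_plus_iff plus_to_left_def; fastforce)
  moreover have "alg_plus E r l \<longleftrightarrow> type_I_plus E r l"
    using True plusD(5)[of r a] by (auto simp: alg_plus_def type_II_row_def)
  ultimately show ?thesis
    using type_I_plus_iff[OF r True l] gain by auto
\<comment> \<open>Above row \<open>a\<close> and left of column \<open>a\<close>, a row of type (II)
  is copied and any other row is all 0 by \<open>plus_left_of_new_row\<close>.\<close>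
next
  case False
  then have "r < a" "a < l" using l(2) by auto
  then have "r \<noteq> gain_row l"
    using gain_row_in[OF l] by (auto simp: restricted_rows_def)
  moreover have "r \<in> R" using r(1) \<open>r < a\<close> by (simp add: alg_rows_def)
  moreover have "\<not> enat l < leftmost_plus E r" "(r, l) \<notin> P" if "(r, a) \<notin> P"
    using that plus_left_of_new_row[OF \<open>r < a\<close>] \<open>r < a\<close> \<open>a < l\<close>
    by (auto simp: less_leftmost_plus_iff[OF r(1)] plus_to_left_def dest: less_trans)
  ultimately show ?thesis
    using \<open>a < l\<close> l(2)
    by (auto simp: alg_plus_def type_II_row_def type_I_plus_def lost_plus_iff)
qed

section \<open>The pluses of the output and their number\<close>

lemma alg_col_labels: "col_labels (alg_filling E) = col_labels E - {a}"
  by (auto simp: col_labels_def alg_filling_def alg_rows_def)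

lemma pluses_alg_filling:
  "pluses (alg_filling E) =
     (P - lost_plus ` R) \<union> (\<lambda>l. (gain_row l, l)) ` (col_labels E - {a})"
proof -
  have "(r, l) \<in> pluses (alg_filling E) \<longleftrightarrow>
      r \<in> alg_rows E \<and> r < l \<and> l \<in> col_labels E - {a} \<and>
      ((r, l) \<in> P - lost_plus ` R \<or> r = gain_row l)" for r l
    using alg_plus_iff[of r l] alg_col_labels
    by (auto simp: alg_filling_def col_labels_def)
  \<comment> \<open>Here \<open>l \<noteq> a\<close> holds because every plus of column
    \<open>a\<close> is lost.\<close>
  moreover have "r \<in> alg_rows E \<and> r < l \<and> l \<in> col_labels E - {a}"
    if "(r, l) \<in> P - lost_plus ` R" for r l
    using that plusD[of r l]
    by (auto simp: alg_rows_def col_labels_def num_steps_eq lost_plus_iff)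
  moreover have "gain_row l \<in> alg_rows E \<and> gain_row l < l" if "l \<in> col_labels E - {a}" for l
    using gain_row_in[of l] that by (simp add: restricted_rows_def)
  ultimately have "(r, l) \<in> pluses (alg_filling E) \<longleftrightarrow>
      (r, l) \<in> P - lost_plus ` R \<or> l \<in> col_labels E - {a} \<and> r = gain_row l" for r l
    by blast
  then show ?thesis by auto
qed

lemma loopless_alg_filling: "loopless (alg_filling E)"
  unfolding loopless_def
proof
  fix l assume l: "l \<in> col_labels (alg_filling E)"
  then have "(gain_row l, l) \<in> pluses (alg_filling E)"
    by (simp add: alg_col_labels pluses_alg_filling)
  moreover from this have "(gain_row l, l) \<in> boxes (alg_filling E)"
    using l by (simp add: boxes_def) (simp add: alg_filling_def)
  ultimately show "\<exists>r. (r, l) \<in> boxes (alg_filling E) \<and> (r, l) \<in> pluses (alg_filling E)"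
    by blast
qed

lemma cell_dim_alg_filling:
  "int (cell_dim (alg_filling E)) = int (cell_dim E) - 2 * int k + (int n - 1)"
proof -
  let ?X = "(\<lambda>l. (gain_row l, l)) ` (col_labels E - {a})"
  have "card (lost_plus ` R) = k"
    using card_rows by (subst card_image) (auto simp: inj_on_def lost_plus_def)
  moreover have "lost_plus ` R \<subseteq> P" using lost_plus_in by auto
  ultimately have lost: "int (card (P - lost_plus ` R)) = int (card P) - int k"
    using finite_pluses
    by (metis card_Diff_subset card_mono finite_subset of_nat_diff)
  have "card (col_labels E) = n - k" "k \<le> n"
    using rows_subset finite_rows card_rows card_mono[OF _ rows_subset]
    by (simp_all add: col_labels_def num_steps_eq card_Diff_subset)
  moreover have "finite (col_labels E)" by (simp add: col_labels_def)
  \<comment> \<open>The column label \<open>a\<close> gives \<open>k < n\<close>, so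
    \<open>n - k - 1\<close> does not truncate.\<close>
  moreover from this have "0 < card (col_labels E)"
    using new_row_col by (auto simp: card_gt_0_iff)
  ultimately have cols: "int (card (col_labels E - {a})) = int n - int k - 1"
    using new_row_col by simp
  have gain: "card ?X = card (col_labels E - {a})"
    by (rule card_image) (auto simp: inj_on_def)
  have "P \<inter> ?X = {}"
    using gain_row_in by (auto simp: restricted_rows_def)
  then have "card (pluses (alg_filling E)) = card (P - lost_plus ` R) + card ?X"
    unfolding pluses_alg_filling using finite_pluses
    by (intro card_Un_disjoint) (auto simp: col_labels_def)
  then show ?thesis
    using lost cols gain by (simp add: cell_dim_def)
qed

end

theorem mainTheorem10:
  fixes k n :: nat and E :: filling
  assumes "1 \<le> n"
    and "le_diagram k n E"
    and "co_loopless E"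
  shows "loopless (alg_filling E) \<and>
         int (cell_dim (alg_filling E)) = int (cell_dim E) - 2 * int k + (int n - 1)"
proof -
  interpret co_loopless_le_diagram k n E
    by unfold_locales (fact assms)+
  show ?thesis
    using loopless_alg_filling cell_dim_alg_filling by blast
qed

end
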